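(* Let $\mathcal{R}$ be a commutative Frobenius ring, let $n$ be a positive integer, and let $\lambda\in\mathcal{R}$ satisfy $\lambda^{2}=1$. Let $A,B,C,D$ be $n\times n$ $\lambda$-circulant matrices over $\mathcal{R}$ satisfying $$AA^{T}+BB^{T}+CC^{T}+DD^{T}=-I_{n}$$ and $$AB^{T}-BA^{T}+CD^{T}-DC^{T}=0.$$ Let $\mathcal{C}$ be the linear code over $\mathcal{R}$ of length $8n$ generated by (the rows of) the $4n\times 8n$ matrix $$G=\left(\; I_{4n}\;\left|\;\begin{array}{cccc} A & B & C & D \\ -B & A & -D & C \\ -C^{T} & D^{T} & A^{T} & -B^{T} \\ -D^{T} & -C^{T} & B^{T} & A^{T}\end{array}\right.\right).$$ Then $\mathcal{C}$ is self-dual.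
   Context: Rings are finite, commutative, with identity. A linear code of length $m$ over a ring $\mathcal{R}$ is an $\mathcal{R}$-submodule of $\mathcal{R}^{m}$. The inner product on $\mathcal{R}^{m}$ is $\langle \mathbf{u},\mathbf{v}\rangle=\sum_{i=1}^{m}u_iv_i$. The dual of a code $\mathcal{C}\subseteq\mathcal{R}^{m}$ is $\mathcal{C}^{\perp}=\{\mathbf{v}\in\mathcal{R}^{m}\mid \langle\mathbf{u},\mathbf{v}\rangle=0\text{ for all }\mathbf{u}\in\mathcal{C}\}$, and $\mathcal{C}$ is self-dual if $\mathcal{C}=\mathcal{C}^{\perp}$. For $\lambda\in\mathcal{R}$, the $\lambda$-circular shift is $\sigma_\lambda(a_1,a_2,\dots,a_n)=(\lambda a_n,a_1,\dots,a_{n-1})$. An $n\times n$ matrix over $\mathcal{R}$ is $\lambda$-circulant if its rows are, in order, $\overline{r},\sigma_\lambda(\overline{r}),\sigma_\lambda^2(\overline{r}),\dots,\sigma_\lambda^{n-1}(\overline{r})$, where $\overline{r}\in\mathcal{R}^n$ is its first row. $M^T$ denotes the transpose of $M$ and $I_k$ the $k\times k$ identity matrix. *)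

theory Defs
  imports "HOL-Algebra.QuotRing" "Jordan_Normal_Form.VS_Connect"
begin

text \<open>
  Frobenius rings. The Jacobson radical is intersected with the carrier only so that the zero ring,
  which has no maximal ideal, is treated correctly.
\<close>

definition jacobson_radical :: "('a, 'b) ring_scheme \<Rightarrow> 'a set" where
  "jacobson_radical R = carrier R \<inter> \<Inter>{M. maximalideal M R}"

definition minimal_ideal :: "'a set \<Rightarrow> ('a, 'b) ring_scheme \<Rightarrow> bool" where
  "minimal_ideal I R \<longleftrightarrow> ideal I R \<and> I \<noteq> {\<zero>\<^bsub>R\<^esub>} \<and>
     (\<forall>J. ideal J R \<and> J \<subseteq> I \<longrightarrow> J = {\<zero>\<^bsub>R\<^esub>} \<or> J = I)"

definition socle :: "('a, 'b) ring_scheme \<Rightarrow> 'a set" where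
  "socle R = Idl\<^bsub>R\<^esub> (\<Union>{I. minimal_ideal I R})"

text \<open>The ring modulo an ideal, and an ideal, as modules over the ring.\<close>

definition quotient_module :: "('a, 'b) ring_scheme \<Rightarrow> 'a set \<Rightarrow> ('a, 'a set) module" where
  "quotient_module R I = ring.extend (R Quot I)
     \<lparr>smult = (\<lambda>r X. (I +>\<^bsub>R\<^esub> r) \<otimes>\<^bsub>R Quot I\<^esub> X)\<rparr>"

definition ideal_module :: "('a, 'b) ring_scheme \<Rightarrow> 'a set \<Rightarrow> ('a, 'a) module" where
  "ideal_module R I = \<lparr>carrier = I, mult = mult R, one = one R, zero = zero R, add = add R,
     smult = mult R\<rparr>"

text \<open>
  A finite commutative ring is Frobenius if its quotient by the Jacobson radical is isomorphic, as
  a module over the ring, to its socle. By commutativity left and right modules need not be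
  distinguished.
\<close>

definition frobenius_ring :: "('a, 'b) ring_scheme \<Rightarrow> bool" where
  "frobenius_ring R \<longleftrightarrow> cring R \<and> finite (carrier R) \<and>
     (\<exists>f \<in> LinearCombinations.module_hom R (quotient_module R (jacobson_radical R)) (ideal_module R (socle R)).
        bij_betw f (carrier (quotient_module R (jacobson_radical R)))
          (carrier (ideal_module R (socle R))))"

definition generated_code :: "'a :: comm_ring_1 mat \<Rightarrow> 'a vec set" where
  "generated_code G =
     LinearCombinations.module.span class_ring (module_vec TYPE('a) (dim_col G)) (set (rows G))"

definition dual_code :: "nat \<Rightarrow> 'a :: comm_ring_1 vec set \<Rightarrow> 'a vec set" where
  "dual_code m C = {v \<in> carrier_vec m. \<forall>u \<in> C. u \<bullet> v = 0}"

definition self_dual :: "nat \<Rightarrow> 'a :: comm_ring_1 vec set \<Rightarrow> bool" where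
  "self_dual m C \<longleftrightarrow> C = dual_code m C"

definition circular_shift :: "'a :: comm_ring_1 \<Rightarrow> 'a vec \<Rightarrow> 'a vec" where
  "circular_shift c a =
     vec (dim_vec a) (\<lambda>i. if i = 0 then c * a $ (dim_vec a - 1) else a $ (i - 1))"

definition circulant :: "nat \<Rightarrow> 'a :: comm_ring_1 \<Rightarrow> 'a mat \<Rightarrow> bool" where
  "circulant n c M \<longleftrightarrow> M \<in> carrier_mat n n \<and>
     (\<exists>r \<in> carrier_vec n. \<forall>i<n. row M i = (circular_shift c ^^ i) r)"

definition append_cols :: "'a :: zero mat \<Rightarrow> 'a mat \<Rightarrow> 'a mat" where
  "append_cols A B = four_block_mat A B (0\<^sub>m 0 (dim_col A)) (0\<^sub>m 0 (dim_col B))"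

end

theory Submission
  imports Defs
begin

text \<open>
  Let \<open>N\<close> be the right half of the generator matrix. If \<open>N * N\<^sup>T = - 1\<close> then the code generated
  by \<open>(1 | N)\<close> is self-dual. Indeed its words are the pairs \<open>(u, N\<^sup>T u)\<close>, so \<open>(x, y)\<close> lies in the dual
  code exactly when \<open>x + N y = 0\<close>. As \<open>N\<close> is square, \<open>- N\<^sup>T\<close> is a two-sided inverse of \<open>N\<close>,
  so this equation can be solved for \<open>y\<close> as \<open>y = N\<^sup>T x\<close>, which is the equation of the code. This is
  \<open>self_dual_standard_form\<close>.

  To compute \<open>N * N\<^sup>T\<close>, group the blocks in fours. A matrix of shape \<open>(P, Q; - Q, P)\<close>
  behaves like the complex number \<open>P + i Q\<close>, transposition being conjugation combined with
  transposition of the blocks. With \<open>X = A + i B\<close> and \<open>Y = C + i D\<close> one has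
  \<open>N = (X, Y; - Y\<^sup>T, X\<^sup>T)\<close>, which has the shape of a quaternion. The two hypotheses on
  \<open>A, B, C, D\<close> are the real and imaginary parts of \<open>X * X\<^sup>T + Y * Y\<^sup>T = - 1\<close>, and
  \<open>N * N\<^sup>T = - 1\<close> follows as soon as \<open>X\<close> and \<open>Y\<close> commute with each other and each of them commutes
  with its own transpose (\<open>bordered_normal_block_orthogonality\<close>).

  These commutation relations hold because \<open>\<lambda>\<close>-circulant matrices commute (they are the polynomials
  in a single shift matrix) and, for \<open>\<lambda>\<^sup>2 = 1\<close>, the transpose of a \<open>\<lambda>\<close>-circulant matrix is again
  \<open>\<lambda>\<close>-circulant: \<open>circulant_commute\<close> and \<open>circulant_transpose\<close>.
\<close>

section \<open>Circulant matrices with a twist\<close>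

text \<open>
  As long as the number of shifts is at most \<open>n\<close>, every coordinate passes the end of the vector at
  most once and so picks up at most one factor \<open>c\<close>.
\<close>
lemma circular_shift_funpow_index:
  assumes r: "r \<in> carrier_vec n" and "i \<le> n" and "j < n"
  shows "((circular_shift c ^^ i) r) $ j = (if i \<le> j then r $ (j - i) else c * r $ (n + j - i))"
proof -
  have dim: "dim_vec ((circular_shift c ^^ i) r) = n" for i
    using r by (induction i) (auto simp: circular_shift_def)
  show ?thesis using \<open>i \<le> n\<close> \<open>j < n\<close>
  proof (induction i arbitrary: j)
    case (Suc i)
    show ?case
    proof (cases j)
      case 0
      have "((circular_shift c ^^ Suc i) r) $ j = c * ((circular_shift c ^^ i) r) $ (n - 1)"
        using Suc.prems 0 dim[of i] by (simp add: circular_shift_def)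
      also have "((circular_shift c ^^ i) r) $ (n - 1) = r $ (n - 1 - i)"
        using Suc.IH[of "n - 1"] Suc.prems by (auto simp: not_le)
      finally show ?thesis using Suc.prems 0 by (simp add: diff_diff_add)
    next
      case (Suc k)
      have "((circular_shift c ^^ Suc i) r) $ j = ((circular_shift c ^^ i) r) $ k"
        using Suc.prems Suc dim[of i] by (simp add: circular_shift_def)
      then show ?thesis using Suc.IH[of k] Suc.prems Suc by simp
    qed
  qed simp
qed

lemma circulant_iff_entries:
  "circulant n c M \<longleftrightarrow> M \<in> carrier_mat n n \<and>
     (\<exists>r. \<forall>i<n. \<forall>j<n. M $$ (i, j) = (if i \<le> j then r (j - i) else c * r (n + j - i)))"
  (is "_ \<longleftrightarrow> _ \<and> (\<exists>r. ?entries r)")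
proof (intro iffI conjI)
  assume M: "circulant n c M"
  then show "M \<in> carrier_mat n n"
    by (simp add: circulant_def)
  from M obtain r where r: "r \<in> carrier_vec n" and rows: "\<forall>i<n. row M i = (circular_shift c ^^ i) r"
    by (auto simp: circulant_def)
  have "M $$ (i, j) = (if i \<le> j then r $ (j - i) else c * r $ (n + j - i))"
    if "i < n" "j < n" for i j
  proof -
    have "M $$ (i, j) = row M i $ j"
      using that \<open>M \<in> carrier_mat n n\<close> by simp
    then show ?thesis
      using that rows circular_shift_funpow_index[OF r, of i j c] by simp
  qed
  then have "?entries (\<lambda>k. r $ k)" by blast
  then show "\<exists>r. ?entries r" by blast
next
  assume "M \<in> carrier_mat n n \<and> (\<exists>r. ?entries r)"
  then obtain r where M: "M \<in> carrier_mat n n" and r: "?entries r"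
    by blast
  have dim: "dim_vec ((circular_shift c ^^ i) (vec n r)) = n" for i
    by (induction i) (auto simp: circular_shift_def)
  have "row M i = (circular_shift c ^^ i) (vec n r)" if "i < n" for i
  proof (rule eq_vecI)
    fix j assume "j < dim_vec ((circular_shift c ^^ i) (vec n r))"
    then show "row M i $ j = (circular_shift c ^^ i) (vec n r) $ j"
      using M r that circular_shift_funpow_index[of "vec n r" n i j c] by (simp add: dim)
  qed (use M dim in simp)
  then show "circulant n c M"
    unfolding circulant_def using M by (meson vec_carrier)
qed

text \<open>
  Both \<open>M * N\<close> and \<open>N * M\<close> are twisted cyclic convolutions of the first rows. The
  substitution \<open>k \<mapsto> i + j - k\<close> modulo \<open>n\<close> turns the sum for the \<open>(i, j)\<close> entry of \<open>M * N\<close> into the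
  one for \<open>N * M\<close>: it exchanges the offsets \<open>k - i\<close> and \<open>j - k\<close>, and it preserves the total number
  of wrap-arounds, hence the power of \<open>c\<close>.
\<close>
lemma circulant_commute:
  assumes "circulant n c M" and "circulant n c N"
  shows "M * N = N * M"
proof -
  obtain r s where M: "M \<in> carrier_mat n n" and N: "N \<in> carrier_mat n n"
    and r: "\<And>i j. i < n \<Longrightarrow> j < n \<Longrightarrow>
      M $$ (i, j) = (if i \<le> j then r (j - i) else c * r (n + j - i))"
    and s: "\<And>i j. i < n \<Longrightarrow> j < n \<Longrightarrow>
      N $$ (i, j) = (if i \<le> j then s (j - i) else c * s (n + j - i))"
    using assms unfolding circulant_iff_entries by metis
  show ?thesis
  proof (rule eq_matI)
    fix i j assume "i < dim_row (N * M)" "j < dim_col (N * M)"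
    then have ij: "i < n" "j < n" using M N by auto
    \<comment> \<open>The representative of \<open>i + j - k\<close> modulo \<open>n\<close> in the range \<open>{0..<n}\<close>; it is an involution.\<close>
    let ?\<tau> = "\<lambda>k. if i + j < k then i + j + n - k else if i + j - k < n then i + j - k else i + j - k - n"
    have "(M * N) $$ (i, j) = (\<Sum>k = 0..<n. M $$ (i, k) * N $$ (k, j))"
      using ij M N by (simp add: scalar_prod_def)
    also have "\<dots> = (\<Sum>k = 0..<n. N $$ (i, k) * M $$ (k, j))"
    proof (rule sum.reindex_bij_witness[of _ ?\<tau> ?\<tau>])
      fix k assume k: "k \<in> {0..<n}"
      then have k': "?\<tau> k < n" using ij by auto
      \<comment> \<open>The cases are distinguished by the multiple of \<open>n\<close> used in the reduction. If it is not zero,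
        exactly one of the two factors wraps around on either side.\<close>
      consider "i + j < k" | "k \<le> i + j" "i + j < k + n" | "k + n \<le> i + j" by linarith
      then show "N $$ (i, ?\<tau> k) * M $$ (?\<tau> k, j) = M $$ (i, k) * N $$ (k, j)"
      proof cases
        case 1
        have e: "i + j + n - k - i = n + j - k" "n + j - (i + j + n - k) = k - i"
          "j + n - k = n + j - k" using 1 k by auto
        show ?thesis using 1 k k' ij by (auto simp: r s e)
      next
        case 2
        have e: "k \<le> j \<Longrightarrow> i + j - k - i = j - k" "j < k \<Longrightarrow> n + (i + j - k) - i = n + j - k"
          "i \<le> k \<Longrightarrow> j - (i + j - k) = k - i" "k < i \<Longrightarrow> n + j - (i + j - k) = n + k - i"
          using 2 by auto
        have "i \<le> i + j - k \<longleftrightarrow> k \<le> j" "i + j - k \<le> j \<longleftrightarrow> i \<le> k" using 2 by auto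
        with 2 k k' ij show ?thesis by (auto simp: r s e algebra_simps)
      next
        case 3
        have e: "n + (i + j - k - n) - i = j - k" "j - (i + j - k - n) = n + k - i"
          "k + n - i = n + k - i" using 3 k ij by auto
        have "k < i" "k \<le> j" "\<not> i \<le> i + j - k - n" "i + j - k - n \<le> j" using 3 k ij by auto
        with 3 k k' ij show ?thesis by (auto simp: r s e mult.assoc mult.left_commute mult.commute)
      qed
    qed (use ij in auto)
    also have "\<dots> = (N * M) $$ (i, j)"
      using ij M N by (simp add: scalar_prod_def)
    finally show "(M * N) $$ (i, j) = (N * M) $$ (i, j)" .
  qed (use M N in auto)
qed

text \<open>
  Transposition moves the factor \<open>c\<close> from below the diagonal to above it, where the new first row
  absorbs it. The entries below the diagonal then have to be \<open>c\<close> times an entry that already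
  contains \<open>c\<close>, and \<open>c * c = 1\<close> shows that they are.
\<close>
lemma circulant_transpose:
  assumes "circulant n c M" and c: "c ^ 2 = 1"
  shows "circulant n c M\<^sup>T"
proof -
  obtain r where M: "M \<in> carrier_mat n n"
    and r: "\<And>i j. i < n \<Longrightarrow> j < n \<Longrightarrow>
      M $$ (i, j) = (if i \<le> j then r (j - i) else c * r (n + j - i))"
    using assms(1) unfolding circulant_iff_entries by metis
  let ?s = "\<lambda>k. if k = 0 then r 0 else c * r (n - k)"
  have cc: "c * (c * x) = x" for x
    using c by (simp add: power2_eq_square flip: mult.assoc)
  have "M\<^sup>T $$ (i, j) = (if i \<le> j then ?s (j - i) else c * ?s (n + j - i))"
    if "i < n" "j < n" for i j
  proof -
    have "n - (n + j - i) = i - j" "i \<le> j \<Longrightarrow> n - (j - i) = n + i - j" using that by auto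
    with that M show ?thesis by (auto simp: r cc)
  qed
  then show ?thesis
    unfolding circulant_iff_entries using M by (intro conjI exI[of _ ?s]) auto
qed

section \<open>Block matrices\<close>

text \<open>The matrix of \<open>P + i Q\<close>, where \<open>i\<close> is a formal square root of \<open>- 1\<close>.\<close>

definition complex_block :: "'a :: comm_ring_1 mat \<Rightarrow> 'a mat \<Rightarrow> 'a mat" where
  "complex_block P Q = four_block_mat P Q (- Q) P"

lemma complex_block_carrier:
  "P \<in> carrier_mat n n \<Longrightarrow> complex_block P Q \<in> carrier_mat (n + n) (n + n)"
  unfolding complex_block_def by (rule four_block_carrier_mat)

lemma complex_block_mult:
  assumes P: "P \<in> carrier_mat n n" and Q: "Q \<in> carrier_mat n n"
    and R: "R \<in> carrier_mat n n" and S: "S \<in> carrier_mat n n"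
  shows "complex_block P Q * complex_block R S = complex_block (P * R - Q * S) (P * S + Q * R)"
proof -
  have "complex_block P Q * complex_block R S
    = four_block_mat (P * R + Q * - S) (P * S + Q * R) (- Q * R + P * - S) (- Q * S + P * R)"
    unfolding complex_block_def by (rule mult_four_block_mat) (use assms in auto)
  also have "\<dots> = complex_block (P * R - Q * S) (P * S + Q * R)"
    unfolding complex_block_def
    by (rule cong_four_block_mat; rule eq_matI) (use assms in auto)
  finally show ?thesis .
qed

lemma complex_block_commute:
  assumes "P \<in> carrier_mat n n" "Q \<in> carrier_mat n n" "R \<in> carrier_mat n n" "S \<in> carrier_mat n n"
    and "P * R = R * P" "Q * S = S * Q" "P * S = S * P" "Q * R = R * Q"
  shows "complex_block P Q * complex_block R S = complex_block R S * complex_block P Q"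
proof -
  have "S * P + R * Q = R * Q + S * P"
    by (rule comm_add_mat) (use assms in auto)
  with assms show ?thesis
    by (simp add: complex_block_mult[of _ n])
qed

lemma complex_block_transpose:
  assumes "P \<in> carrier_mat n n" "Q \<in> carrier_mat n n"
  shows "(complex_block P Q)\<^sup>T = complex_block P\<^sup>T (- Q\<^sup>T)"
  unfolding complex_block_def using assms
  by (subst transpose_four_block_mat[of _ n n _ n _ n]) (auto simp: transpose_uminus)

lemma complex_block_mult_transpose:
  assumes P: "P \<in> carrier_mat n n" and Q: "Q \<in> carrier_mat n n"
  shows "complex_block P Q * (complex_block P Q)\<^sup>T
    = complex_block (P * P\<^sup>T + Q * Q\<^sup>T) (- (P * Q\<^sup>T - Q * P\<^sup>T))"
proof -
  have "P * P\<^sup>T - Q * - Q\<^sup>T = P * P\<^sup>T + Q * Q\<^sup>T"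
    and "P * - Q\<^sup>T + Q * P\<^sup>T = - (P * Q\<^sup>T - Q * P\<^sup>T)"
    using P Q by (auto intro!: eq_matI)
  then show ?thesis
    using P Q by (simp add: complex_block_transpose complex_block_mult[of _ n])
qed

lemma complex_block_add:
  assumes "P \<in> carrier_mat n n" "Q \<in> carrier_mat n n" "R \<in> carrier_mat n n" "S \<in> carrier_mat n n"
  shows "complex_block P Q + complex_block R S = complex_block (P + R) (Q + S)"
  unfolding complex_block_def by (rule eq_matI) (use assms in auto)

text \<open>
  The off-diagonal blocks of \<open>N * N\<^sup>T\<close> are \<open>Y * X - X * Y\<close> and its transpose. The upper
  diagonal block is the assumed sum, and the lower one is \<open>Y\<^sup>T * Y + X\<^sup>T * X\<close>, which normality of
  \<open>X\<close> and \<open>Y\<close> turns into the same sum.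
\<close>
lemma bordered_normal_block_orthogonality:
  fixes X Y :: "'a :: comm_ring_1 mat"
  assumes X: "X \<in> carrier_mat m m" and Y: "Y \<in> carrier_mat m m"
    and XY: "X * Y = Y * X"
    and normal: "X\<^sup>T * X = X * X\<^sup>T" "Y\<^sup>T * Y = Y * Y\<^sup>T"
    and sum: "X * X\<^sup>T + Y * Y\<^sup>T = - 1\<^sub>m m"
  defines "N \<equiv> four_block_mat X Y (- Y\<^sup>T) X\<^sup>T"
  shows "N * N\<^sup>T = - 1\<^sub>m (m + m)"
proof -
  have "N\<^sup>T = four_block_mat X\<^sup>T (- Y) Y\<^sup>T X"
    unfolding N_def using X Y
    by (subst transpose_four_block_mat[of _ m m _ m _ m]) (auto simp: transpose_uminus)
  then have "N * N\<^sup>T = four_block_mat (X * X\<^sup>T + Y * Y\<^sup>T) (X * - Y + Y * X)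
      (- Y\<^sup>T * X\<^sup>T + X\<^sup>T * Y\<^sup>T) (- Y\<^sup>T * - Y + X\<^sup>T * X)"
    unfolding N_def by (simp only:) (rule mult_four_block_mat; use X Y in auto)
  also have "\<dots> = four_block_mat (- 1\<^sub>m m) (0\<^sub>m m m) (0\<^sub>m m m) (- 1\<^sub>m m)"
  proof (rule cong_four_block_mat)
    show "X * - Y + Y * X = 0\<^sub>m m m"
      using X Y by (simp add: XY uminus_l_inv_mat[of _ m m])
    have "X\<^sup>T * Y\<^sup>T = Y\<^sup>T * X\<^sup>T"
      using X Y XY by (metis transpose_mult)
    then show "- Y\<^sup>T * X\<^sup>T + X\<^sup>T * Y\<^sup>T = 0\<^sub>m m m"
      using X Y by (simp add: uminus_l_inv_mat[of _ m m])
    have "- Y\<^sup>T * - Y + X\<^sup>T * X = Y * Y\<^sup>T + X * X\<^sup>T"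
      using X Y by (simp add: normal)
    also have "\<dots> = X * X\<^sup>T + Y * Y\<^sup>T"
      by (rule comm_add_mat) (use X Y in auto)
    finally show "- Y\<^sup>T * - Y + X\<^sup>T * X = - 1\<^sub>m m"
      by (simp add: sum)
  qed (rule sum)
  also have "\<dots> = - 1\<^sub>m (m + m)"
    by (rule eq_matI) auto
  finally show ?thesis .
qed

section \<open>Codes in standard form\<close>

text \<open>
  A span is built from coefficients attached to vectors, so that repeated rows of \<open>G\<close> are
  counted once. Attaching the coefficients to row indices instead, as a coefficient vector does,
  yields the same combinations.
\<close>
lemma generated_code_eq_combinations:
  fixes G :: "'a :: comm_ring_1 mat"
  shows "generated_code G = {G\<^sup>T *\<^sub>v u | u. u \<in> carrier_vec (dim_row G)}"
proof -
  interpret vec_module "TYPE('a)" "dim_col G" .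
  let ?S = "set (rows G)"
  have S: "?S \<subseteq> carrier_vec (dim_col G)"
    by (rule rows_carrier)
  have cols: "mat_of_cols (dim_col G) (rows G) = G\<^sup>T"
    by (metis cols_transpose index_transpose_mat(2) mat_of_cols_cols)
  have span: "span ?S = {lincomb a ?S | a. True}"
    using finite_span[OF finite_set S] by simp
  have "lincomb a ?S \<in> {G\<^sup>T *\<^sub>v u | u. u \<in> carrier_vec (dim_row G)}" for a
  proof -
    have "\<forall>w \<in> ?S. dim_vec w = dim_col G"
      using S by (meson carrier_vecD subsetD)
    then obtain c where "lincomb a ?S = G\<^sup>T *\<^sub>v vec (dim_row G) c"
      using lincomb_as_lincomb_list[OF S] by (auto simp: lincomb_list_as_mat_mult cols)
    then show ?thesis
      using vec_carrier by blast
  qed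
  moreover have "\<exists>a. G\<^sup>T *\<^sub>v u = lincomb a ?S" if "u \<in> carrier_vec (dim_row G)" for u
    using mat_of_cols_mult_as_finsum[of u "rows G"] that by (auto simp: cols)
  ultimately show ?thesis
    unfolding generated_code_def span by blast
qed

text \<open>
  Rank arguments fail over a ring with zero divisors, but multiplicativity of the determinant still
  makes \<open>det A\<close> a unit. Therefore \<open>B\<close> has to be the adjugate of \<open>A\<close> divided by \<open>det A\<close>,
  and the adjugate commutes with \<open>A\<close>.
\<close>
lemma right_inverse_mat_is_left_inverse:
  fixes A B :: "'a :: comm_ring_1 mat"
  assumes A: "A \<in> carrier_mat n n" and B: "B \<in> carrier_mat n n" and AB: "A * B = 1\<^sub>m n"
  shows "B * A = 1\<^sub>m n"
proof -
  have det: "det B * det A = 1"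
    using det_mult[OF A B] AB by (simp add: mult.commute)
  note adj = adj_mat[OF A]
  have "det A \<cdot>\<^sub>m B = (adj_mat A * A) * B"
    using adj B by (simp add: mult_smult_assoc_mat[of _ n n _ n])
  also have "\<dots> = adj_mat A"
    using assoc_mult_mat[OF adj(1) A B] adj(1) AB by simp
  finally have "det B \<cdot>\<^sub>m (det A \<cdot>\<^sub>m B) = det B \<cdot>\<^sub>m adj_mat A"
    by simp
  moreover have scale: "det B \<cdot>\<^sub>m (det A \<cdot>\<^sub>m M) = M" for M
    by (rule eq_matI) (simp_all add: det flip: mult.assoc)
  ultimately have "B = det B \<cdot>\<^sub>m adj_mat A"
    by metis
  then have "B * A = det B \<cdot>\<^sub>m (adj_mat A * A)"
    using adj A by (metis mult_smult_assoc_mat)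
  then show ?thesis
    by (simp add: adj scale)
qed

text \<open>
  Both the code and its dual are described by a linear relation between the two halves \<open>x\<close> and \<open>y\<close> of
  a word: \<open>y = N\<^sup>T x\<close> and \<open>x + N y = 0\<close>. The assumption makes \<open>- N\<^sup>T\<close> the inverse of \<open>N\<close>, and the
  relations become equivalent.
\<close>
lemma self_dual_standard_form:
  fixes N :: "'a :: comm_ring_1 mat"
  assumes N: "N \<in> carrier_mat k k" and orth: "N * N\<^sup>T = - 1\<^sub>m k"
  shows "self_dual (k + k) (generated_code (append_cols (1\<^sub>m k) N))"
proof -
  let ?G = "append_cols (1\<^sub>m k) N"
  have orth': "N\<^sup>T * N = - 1\<^sub>m k"
  proof -
    have "N * (- N\<^sup>T) = 1\<^sub>m k"
      using N by (simp add: orth)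
    then have "(- N\<^sup>T) * N = 1\<^sub>m k"
      using N by (intro right_inverse_mat_is_left_inverse[of N k]) auto
    then have "- (N\<^sup>T * N) = 1\<^sub>m k"
      using N by simp
    then show ?thesis by (metis uminus_uminus_mat)
  qed
  have G: "?G \<in> carrier_mat k (k + k)"
    using four_block_carrier_mat[of "1\<^sub>m k" k k "0\<^sub>m 0 k" 0 k] N unfolding append_cols_def by auto
  have GT: "?G\<^sup>T *\<^sub>v u = u @\<^sub>v (N\<^sup>T *\<^sub>v u)" if u: "u \<in> carrier_vec k" for u
  proof (rule eq_vecI)
    fix i assume "i < dim_vec (u @\<^sub>v (N\<^sup>T *\<^sub>v u))"
    then have i: "i < k + k" using N u by simp
    have "col ?G i = (if i < k then unit_vec k i else col N (i - k))"
      using N i by (intro eq_vecI) (auto simp: append_cols_def)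
    then show "(?G\<^sup>T *\<^sub>v u) $ i = (u @\<^sub>v (N\<^sup>T *\<^sub>v u)) $ i"
      using i N G u by (auto simp: scalar_prod_left_unit)
  qed (use G N u in auto)
  have code: "generated_code ?G = {u @\<^sub>v (N\<^sup>T *\<^sub>v u) | u. u \<in> carrier_vec k}"
    using G GT unfolding generated_code_eq_combinations by (auto; metis)
  have inner: "(u @\<^sub>v (N\<^sup>T *\<^sub>v u)) \<bullet> (x @\<^sub>v y) = u \<bullet> (x + N *\<^sub>v y)"
    if "u \<in> carrier_vec k" "x \<in> carrier_vec k" "y \<in> carrier_vec k" for u x y
    using that N transpose_vec_mult_scalar[OF N, of y u]
    by (simp add: scalar_prod_append[of _ k _ k] scalar_prod_add_distrib[of _ k])
  have dual: "x @\<^sub>v y \<in> dual_code (k + k) (generated_code ?G) \<longleftrightarrow> x + N *\<^sub>v y = 0\<^sub>v k"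
    if xy: "x \<in> carrier_vec k" "y \<in> carrier_vec k" for x y
  proof
    assume "x @\<^sub>v y \<in> dual_code (k + k) (generated_code ?G)"
    then have *: "u \<bullet> (x + N *\<^sub>v y) = 0" if "u \<in> carrier_vec k" for u
      using that xy inner unfolding dual_code_def code by auto
    have "(x + N *\<^sub>v y) $ i = 0" if "i < k" for i
      using *[of "unit_vec k i"] that N xy by (simp add: scalar_prod_left_unit[of _ k])
    then show "x + N *\<^sub>v y = 0\<^sub>v k"
      using N xy by (intro eq_vecI) auto
  next
    assume "x + N *\<^sub>v y = 0\<^sub>v k"
    then show "x @\<^sub>v y \<in> dual_code (k + k) (generated_code ?G)"
      using xy inner unfolding dual_code_def code by auto
  qed
  have neg_one: "(- 1\<^sub>m k) *\<^sub>v w = - w" if "w \<in> carrier_vec k" for w :: "'a vec"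
    using that by simp
  have cancel: "x + N *\<^sub>v y = 0\<^sub>v k \<longleftrightarrow> y = N\<^sup>T *\<^sub>v x"
    if xy: "x \<in> carrier_vec k" "y \<in> carrier_vec k" for x y
  proof
    assume "x + N *\<^sub>v y = 0\<^sub>v k"
    then have "N\<^sup>T *\<^sub>v x + N\<^sup>T *\<^sub>v (N *\<^sub>v y) = N\<^sup>T *\<^sub>v 0\<^sub>v k"
      using N xy by (metis mult_add_distrib_mat_vec mult_mat_vec_carrier transpose_carrier_mat)
    moreover have "N\<^sup>T *\<^sub>v (N *\<^sub>v y) = - y"
      using N xy neg_one[of y] by (simp add: orth' flip: assoc_mult_mat_vec[of _ k k _ k])
    ultimately have "N\<^sup>T *\<^sub>v x + - y = 0\<^sub>v k"
      using N by auto
    then show "y = N\<^sup>T *\<^sub>v x"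
      using N xy by (intro eq_vecI; simp add: vec_eq_iff)
  next
    assume "y = N\<^sup>T *\<^sub>v x"
    then have "N *\<^sub>v y = - x"
      using N xy neg_one[of x] by (simp add: orth flip: assoc_mult_mat_vec[of _ k k _ k])
    then show "x + N *\<^sub>v y = 0\<^sub>v k"
      using xy by simp
  qed
  have "v \<in> generated_code ?G \<longleftrightarrow> v \<in> dual_code (k + k) (generated_code ?G)"
    if v: "v \<in> carrier_vec (k + k)" for v
  proof -
    define x y where "x = vec_first v k" and "y = vec_last v k"
    have xy: "x \<in> carrier_vec k" "y \<in> carrier_vec k" and v_eq: "v = x @\<^sub>v y"
      using v by (auto simp: x_def y_def)
    have "v \<in> generated_code ?G \<longleftrightarrow> y = N\<^sup>T *\<^sub>v x"
      using xy unfolding v_eq code by (auto simp: append_vec_eq[of _ k])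
    then show ?thesis
      using dual[OF xy] cancel[OF xy] by (simp add: v_eq)
  qed
  moreover have "generated_code ?G \<subseteq> carrier_vec (k + k)"
    using N unfolding code by auto
  moreover have "dual_code (k + k) (generated_code ?G) \<subseteq> carrier_vec (k + k)"
    unfolding dual_code_def by blast
  ultimately show ?thesis
    unfolding self_dual_def by blast
qed

theorem theorem3p1:
  fixes n :: nat and l :: "'a :: {finite, comm_ring_1}" and A B C D :: "'a mat"
  assumes "frobenius_ring (class_ring :: 'a ring)"
    and "n > 0"
    and "l ^ 2 = 1"
    and "circulant n l A" and "circulant n l B" and "circulant n l C" and "circulant n l D"
    and "A * A\<^sup>T + B * B\<^sup>T + C * C\<^sup>T + D * D\<^sup>T = - 1\<^sub>m n"
    and "A * B\<^sup>T - B * A\<^sup>T + C * D\<^sup>T - D * C\<^sup>T = 0\<^sub>m n n"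
  shows "self_dual (8 * n) (generated_code (append_cols (1\<^sub>m (4 * n))
    (four_block_mat
      (four_block_mat A B
                      (- B) A)
      (four_block_mat C D
                      (- D) C)
      (four_block_mat (- C\<^sup>T) (D\<^sup>T)
                      (- D\<^sup>T) (- C\<^sup>T))
      (four_block_mat (A\<^sup>T) (- B\<^sup>T)
                      (B\<^sup>T) (A\<^sup>T)))))"
proof -
  note circ = assms(4-7)
  note circT = circ[THEN circulant_transpose, OF assms(3)]
  have carrier: "A \<in> carrier_mat n n" "B \<in> carrier_mat n n" "C \<in> carrier_mat n n" "D \<in> carrier_mat n n"
    using circ unfolding circulant_def by blast+
  define X Y where "X = complex_block A B" and "Y = complex_block C D"
  have X: "X \<in> carrier_mat (n + n) (n + n)" and Y: "Y \<in> carrier_mat (n + n) (n + n)"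
    unfolding X_def Y_def using carrier by (auto intro: complex_block_carrier)
  have XT: "X\<^sup>T = complex_block A\<^sup>T (- B\<^sup>T)" and YT: "Y\<^sup>T = complex_block C\<^sup>T (- D\<^sup>T)"
    unfolding X_def Y_def using carrier by (auto simp: complex_block_transpose)
  have XY: "X * Y = Y * X"
    unfolding X_def Y_def
    by (rule complex_block_commute[of _ n]) (use carrier circ in \<open>auto intro: circulant_commute\<close>)
  have normal: "X\<^sup>T * X = X * X\<^sup>T" "Y\<^sup>T * Y = Y * Y\<^sup>T"
    unfolding XT YT unfolding X_def Y_def
    by (rule complex_block_commute[of _ n];
        use carrier circ circT in \<open>auto intro: circulant_commute\<close>)+
  \<comment> \<open>The two matrix equations of the hypothesis, read as real and imaginary part.\<close>
  have sum: "X * X\<^sup>T + Y * Y\<^sup>T = - 1\<^sub>m (n + n)"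
  proof -
    have re: "(A * A\<^sup>T + B * B\<^sup>T) + (C * C\<^sup>T + D * D\<^sup>T)
        = A * A\<^sup>T + B * B\<^sup>T + C * C\<^sup>T + D * D\<^sup>T"
      and im: "- (A * B\<^sup>T - B * A\<^sup>T) + - (C * D\<^sup>T - D * C\<^sup>T)
        = - (A * B\<^sup>T - B * A\<^sup>T + C * D\<^sup>T - D * C\<^sup>T)"
      by (rule eq_matI; use carrier in auto)+
    have "X * X\<^sup>T + Y * Y\<^sup>T
      = complex_block ((A * A\<^sup>T + B * B\<^sup>T) + (C * C\<^sup>T + D * D\<^sup>T))
          (- (A * B\<^sup>T - B * A\<^sup>T) + - (C * D\<^sup>T - D * C\<^sup>T))"
      unfolding X_def Y_def using carrier
      by (simp add: complex_block_mult_transpose[of _ n], subst complex_block_add[of _ n]) auto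
    also have "\<dots> = complex_block (- 1\<^sub>m n) (0\<^sub>m n n)"
      unfolding re im assms(8,9) by (rule arg_cong2[where f = complex_block]) auto
    also have "\<dots> = - 1\<^sub>m (n + n)"
      unfolding complex_block_def by (rule eq_matI) auto
    finally show ?thesis .
  qed
  define N where "N = four_block_mat X Y (- Y\<^sup>T) X\<^sup>T"
  have "N * N\<^sup>T = - 1\<^sub>m ((n + n) + (n + n))"
    unfolding N_def by (rule bordered_normal_block_orthogonality[OF X Y XY normal sum])
  moreover have "N \<in> carrier_mat ((n + n) + (n + n)) ((n + n) + (n + n))"
    unfolding N_def using X by (intro four_block_carrier_mat) auto
  moreover have "(n + n) + (n + n) = 4 * n"
    by simp
  ultimately have "self_dual (4 * n + 4 * n) (generated_code (append_cols (1\<^sub>m (4 * n)) N))"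
    by (intro self_dual_standard_form) (simp_all only:)
  moreover have "4 * n + 4 * n = 8 * n"
    by simp
  moreover have "- Y\<^sup>T = four_block_mat (- C\<^sup>T) D\<^sup>T (- D\<^sup>T) (- C\<^sup>T)"
    unfolding YT complex_block_def by (rule eq_matI) (use carrier in auto)
  moreover have "X\<^sup>T = four_block_mat A\<^sup>T (- B\<^sup>T) B\<^sup>T A\<^sup>T"
    unfolding XT complex_block_def by simp
  ultimately show ?thesis
    unfolding N_def by (simp only: X_def Y_def complex_block_def)
qed

end
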